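(* Let $\mathcal L$ be an MR-algebra. Then the caret operation is total on $\mathcal L$: for all $x,y\in\mathcal L$, the meet $x\mathbin{\hat{\ }}y=x\wedge\Delta(x\vee y,y)$ exists in $\mathcal L$.
   Context: A cubic algebra is a join-semilattice with greatest element $1$ and an operation $\Delta$ (only the values $\Delta(y,x)$ with $x\le y$ matter) such that: (1) $x\le y$ implies $\Delta(y,x)\vee x=y$; (2) $x\le y\le z$ implies $\Delta(z,\Delta(y,x))=\Delta(\Delta(z,y),\Delta(z,x))$; (3) $x\le y$ implies $\Delta(y,\Delta(y,x))=x$; (4) $x\le y\le z$ implies $\Delta(z,x)\le\Delta(z,y)$; and, writing $xy=\Delta(1,\Delta(x\vee y,y))\vee y$, (5) $(xy)y=x\vee y$; (6) $x(yz)=y(xz)$. An MR-algebra is a cubic algebra satisfying the MR-axiom: for all $a,b<x$, $\Delta(x,a)\vee b<x$ if and only if the meet (greatest lower bound) $a\wedge b$ does not exist. In a cubic algebra, the caret operation is the partial operation $x\mathbin{\hat{\ }}y=x\wedge\Delta(x\vee y,y)$, defined whenever this meet exists. *)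

theory Defs
  imports "HOL-Library.Lub_Glb"
begin

unbundle lattice_syntax

text \<open>The carrier is a type with a join \<open>\<squnion>\<close> and a greatest element \<open>\<top>\<close>. The operation
  \<open>\<Delta>\<close> is total as a HOL function, but its values \<open>\<Delta> y x\<close> are constrained and used only
  for \<open>x \<le> y\<close>.\<close>

definition cubic_imp ::
  "('a::{semilattice_sup,order_top} \<Rightarrow> 'a \<Rightarrow> 'a) \<Rightarrow> 'a \<Rightarrow> 'a \<Rightarrow> 'a" where
  "cubic_imp \<Delta> x y = \<Delta> \<top> (\<Delta> (x \<squnion> y) y) \<squnion> y"

locale cubic_algebra =
  fixes \<Delta> :: "'a::{semilattice_sup,order_top} \<Rightarrow> 'a \<Rightarrow> 'a"
  assumes delta_sup: "x \<le> y \<Longrightarrow> \<Delta> y x \<squnion> x = y"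
    and delta_delta: "x \<le> y \<Longrightarrow> y \<le> z \<Longrightarrow> \<Delta> z (\<Delta> y x) = \<Delta> (\<Delta> z y) (\<Delta> z x)"
    and delta_invol: "x \<le> y \<Longrightarrow> \<Delta> y (\<Delta> y x) = x"
    and delta_mono: "x \<le> y \<Longrightarrow> y \<le> z \<Longrightarrow> \<Delta> z x \<le> \<Delta> z y"
    and imp_imp: "cubic_imp \<Delta> (cubic_imp \<Delta> x y) y = x \<squnion> y"
    and imp_exchange:
      "cubic_imp \<Delta> x (cubic_imp \<Delta> y z) = cubic_imp \<Delta> y (cubic_imp \<Delta> x z)"

abbreviation is_meet :: "'a::order \<Rightarrow> 'a \<Rightarrow> 'a \<Rightarrow> bool" where
  "is_meet a b m \<equiv> isGlb UNIV {a, b} m"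

locale MR_algebra = cubic_algebra +
  assumes MR: "a < x \<Longrightarrow> b < x \<Longrightarrow> \<Delta> x a \<squnion> b < x \<longleftrightarrow> \<not> (\<exists>m. is_meet a b m)"

text \<open>The caret is a partial operation, represented by its graph: \<open>is_caret \<Delta> x y m\<close> says
  that it is defined at \<open>(x, y)\<close> with value \<open>m\<close>.\<close>

definition is_caret ::
  "('a::{semilattice_sup,order_top} \<Rightarrow> 'a \<Rightarrow> 'a) \<Rightarrow> 'a \<Rightarrow> 'a \<Rightarrow> 'a \<Rightarrow> bool" where
  "is_caret \<Delta> x y m \<longleftrightarrow> is_meet x (\<Delta> (x \<squnion> y) y) m"

end

theory Submission
  imports Defs
begin

text \<open>For \<open>z = x \<squnion> y\<close>, the map \<open>\<Delta> z\<close> is an order automorphism of the ideal below \<open>z\<close>, so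
  \<open>\<Delta> z x \<squnion> \<Delta> z y = \<Delta> z (x \<squnion> y) = z\<close>. The MR-axiom, applied to \<open>x\<close> and \<open>\<Delta> z y\<close>, then
  yields their meet.\<close>

lemma is_meet_iff: "is_meet a b m \<longleftrightarrow> m \<le> a \<and> m \<le> b \<and> (\<forall>l. l \<le> a \<and> l \<le> b \<longrightarrow> l \<le> m)"
  by (auto simp: isGlb_def greatestP_def isLb_def setle_def setge_def)

context cubic_algebra
begin

lemma delta_le: "x \<le> y \<Longrightarrow> \<Delta> y x \<le> y"
  by (metis delta_sup sup_ge1)

text \<open>Monotonicity applied to \<open>\<Delta> y y \<le> y\<close> gives
  \<open>y = \<Delta> y (\<Delta> y y) \<le> \<Delta> y y\<close>.\<close>

lemma delta_self: "\<Delta> y y = y"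
  by (metis delta_invol delta_le delta_mono antisym order_refl)

lemma delta_eq_top_iff: "x \<le> y \<Longrightarrow> \<Delta> y x = y \<longleftrightarrow> x = y"
  by (metis delta_invol delta_self)

lemma delta_sup_delta: "\<Delta> (x \<squnion> y) x \<squnion> \<Delta> (x \<squnion> y) y = x \<squnion> y"
proof -
  let ?z = "x \<squnion> y"
  let ?c = "\<Delta> ?z x \<squnion> \<Delta> ?z y"
  have c: "?c \<le> ?z" by (simp add: delta_le)
  \<comment> \<open>Apply the monotone involution \<open>\<Delta> ?z\<close> to
    \<open>\<Delta> ?z x \<le> ?c\<close>.\<close>
  have "x \<le> \<Delta> ?z ?c" by (metis c delta_invol delta_mono sup_ge1)
  moreover have "y \<le> \<Delta> ?z ?c" by (metis c delta_invol delta_mono sup_ge2)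
  ultimately have "\<Delta> ?z ?c = ?z" by (intro antisym delta_le c) simp
  then show ?thesis using c delta_eq_top_iff by blast
qed

end

theorem lemma2p4:
  fixes \<Delta> :: "'a::{semilattice_sup,order_top} \<Rightarrow> 'a \<Rightarrow> 'a"
  assumes "MR_algebra \<Delta>"
  shows "\<forall>x y. \<exists>m. is_caret \<Delta> x y m"
proof (intro allI)
  interpret MR_algebra \<Delta> by (fact assms)
  fix x y :: 'a
  let ?z = "x \<squnion> y"
  have dz: "\<Delta> ?z y \<le> ?z" by (simp add: delta_le)
  \<comment> \<open>The MR-axiom only speaks of elements strictly below \<open>?z\<close>, so
    comparable \<open>x\<close> and \<open>y\<close> are treated directly.\<close>
  consider "x = ?z" | "y = ?z" | "x < ?z" "y < ?z"
    by (metis sup_ge1 sup_ge2 order_le_less)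
  then show "\<exists>m. is_caret \<Delta> x y m"
  proof cases
    case 1
    then have "is_meet x (\<Delta> ?z y) (\<Delta> ?z y)" using dz by (simp add: is_meet_iff)
    then show ?thesis by (auto simp: is_caret_def)
  next
    case 2
    then have "\<Delta> ?z y = ?z" by (metis delta_self)
    then have "is_meet x (\<Delta> ?z y) x" by (simp add: is_meet_iff)
    then show ?thesis by (auto simp: is_caret_def)
  next
    case 3
    then have b: "\<Delta> ?z y < ?z" using dz delta_eq_top_iff[of y ?z] by (simp add: order_less_le)
    \<comment> \<open>The join \<open>\<Delta> ?z x \<squnion> \<Delta> ?z y\<close> equals
      \<open>?z\<close>, so it is not strictly below \<open>?z\<close> and the meet cannot fail to
      exist.\<close>
    then show ?thesis
      using MR[OF \<open>x < ?z\<close> b] delta_sup_delta[of x y] by (auto simp: is_caret_def)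
  qed
qed

end
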